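(* Let $\Sigma_1,\Sigma_2$ be two discrete-time stochastic linear control systems as described in the context. (a) If $\Sigma_1\cong_{\mathrm{lin}}\Sigma_2$, then $\Sigma_1\cong_{\mathrm{bis}}\Sigma_2$. (b) If $\Sigma_1\cong_{\mathrm{bis}}\Sigma_2$, then $\Sigma_1\cong_{\mathrm{ext}}\Sigma_2$.
   Context: For $i=1,2$, $\Sigma_i$ is the system $x_i(t+1)=A_ix_i(t)+B_iu(t)+G_iw_i(t)$, $y_i(t)=C_ix_i(t)+\nu_i(t)$, $t\in\mathbb{N}$, with $x_i\in\mathbb{R}^{n_i}$, $u\in\mathbb{R}^m$, $w_i\in\mathbb{R}^{l_i}$, $y_i,\nu_i\in\mathbb{R}^p$, where $(w_i(t))_t$ is i.i.d. with $w_i(t)\sim\mathcal N(\mu_i,I_{l_i})$, $(\nu_i(t))_t$ is i.i.d. with $\nu_i(t)\sim\mathcal N(0,\Psi_i)$ ($\Psi_i$ symmetric positive semidefinite), and the two sequences are mutually independent. For a deterministic initial state $x_i^0$ and deterministic input sequence $\mathbf u:\mathbb N\to\mathbb R^m$, $\mathbf x_i|_{x_i^0,\mathbf u}(t)=A_i^tx_i^0+\sum_{\tau=0}^{t-1}A_i^{t-1-\tau}(B_iu(\tau)+G_iw_i(\tau))$ and $\mathbf y_i|_{x_i^0,\mathbf u}(t)=C_i\mathbf x_i|_{x_i^0,\mathbf u}(t)+\nu_i(t)$; $\mathbf P(\cdot\mid x_i^0)$ denotes probability for the process started at $x_i^0$. Two stochastic processes are stochastically equivalent, written $\sim$, if all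 their finite-dimensional joint distributions coincide. For a random vector $v$, $\mathrm{supp}(v)=\{z:\mathbf P(v\in B_\rho(z))>0\ \forall\rho>0\}$. For a relation $\mathcal R\subseteq\mathbb R^{n_1}\times\mathbb R^{n_2}$, $\mathcal R(X_1)=\{x_2:\exists x_1\in X_1,(x_1,x_2)\in\mathcal R\}$, $\mathcal R^{-1}(X_2)=\{x_1:\exists x_2\in X_2,(x_1,x_2)\in\mathcal R\}$; $\mathcal R$ is total if $\mathcal R(\mathbb R^{n_1})=\mathbb R^{n_2}$ and $\mathcal R^{-1}(\mathbb R^{n_2})=\mathbb R^{n_1}$. Linear equivalence: $\Sigma_1\cong_{\mathrm{lin}}\Sigma_2$ if $\Psi_1=\Psi_2$, $n_1=n_2$ and there is an invertible $\mathbb T$ with $A_2=\mathbb TA_1\mathbb T^{-1}$, $B_2=\mathbb TB_1$, $C_2=C_1\mathbb T^{-1}$, $G_2=\mathbb TG_1$, $G_2\mu_2=\mathbb TG_1\mu_1$. External equivalence: for a subspace $\mathcal R\subseteq\mathbb R^{n_1}\times\mathbb R^{n_2}$, $\Sigma_1,\Sigma_2$ have equivalent stochastic external behavior with respect to $\mathcal R$ if $\mathbf y_1|_{x_1^0,\mathbf u}\sim\mathbf y_2|_{x_2^0,\mathbf u}$ for all $(x_1^0,x_2^0)\in\mathcal R$ and all inputs $\mathbf u$; $\Sigma_1\cong_{\mathrm{ext}}\Sigma_2$ if this holds for some total subspace $\mathcal R$. Stochastic bisimulation: a subspace $\mathcal R\subseteq\mathbb R^{n_1}\times\mathbb R^{n_2}$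 is a stochastic bisimulation relation between $\Sigma_1,\Sigma_2$ if for every $(x_1^0,x_2^0)\in\mathcal R$, every input $\mathbf u$ and every $t\in\mathbb N$: (i) for every measurable $X_1\subseteq\mathcal R^{-1}(\mathbb R^{n_2})$, $\mathbf P(\mathbf x_1|_{x_1^0,\mathbf u}(t)\in X_1\mid x_1^0)=\mathbf P(\mathbf x_2|_{x_2^0,\mathbf u}(t)\in\mathcal R(X_1\cap\mathrm{supp}(\mathbf x_1|_{x_1^0,\mathbf u}(t)))\mid x_2^0)$; (ii) for every measurable $X_2\subseteq\mathcal R(\mathbb R^{n_1})$, $\mathbf P(\mathbf x_2|_{x_2^0,\mathbf u}(t)\in X_2\mid x_2^0)=\mathbf P(\mathbf x_1|_{x_1^0,\mathbf u}(t)\in\mathcal R^{-1}(X_2\cap\mathrm{supp}(\mathbf x_2|_{x_2^0,\mathbf u}(t)))\mid x_1^0)$; (iii) $\mathbf y_1|_{x_1^0,\mathbf u}\sim\mathbf y_2|_{x_2^0,\mathbf u}$. $\Sigma_1\cong_{\mathrm{bis}}\Sigma_2$ if a total stochastic bisimulation relation between them exists. *)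

theory Defs
  imports "HOL-Analysis.Analysis" "HOL-Probability.Probability"
begin

text \<open>A discrete-time stochastic linear control system
  x(t+1) = A x(t) + B u(t) + G w(t),  y(t) = C x(t) + nu(t),
  with w(t) iid N(mu, I) and nu(t) iid N(0, Psi).
  State space real^'n, input real^'m, noise real^'l, output real^'p.\<close>

record ('n, 'm, 'l, 'p) slsys =
  sysA :: "real^'n^'n"
  sysB :: "real^'m^'n"
  sysG :: "real^'l^'n"
  sysC :: "real^'n^'p"
  sysMu :: "real^'l"
  sysPsi :: "real^'p^'p"

text \<open>Standing assumption: Psi symmetric positive semidefinite.\<close>
definition valid_sys :: "('n::finite, 'm::finite, 'l::finite, 'p::finite) slsys \<Rightarrow> bool" where
  "valid_sys S \<longleftrightarrow> transpose (sysPsi S) = sysPsi S \<and> (\<forall>x. 0 \<le> x \<bullet> (sysPsi S *v x))"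

text \<open>Standard Gaussian N(0,I) on real^'l (independent standard normal coordinates).\<close>
definition std_gauss :: "(real^'l::finite) measure" where
  "std_gauss = distr (PiM (UNIV::'l set) (\<lambda>_. density lborel std_normal_density)) borel
                     (\<lambda>f. \<chi> i. f i)"

text \<open>Gaussian N(m,S) for positive semidefinite S: image of N(0,I) under z \<mapsto> m + L z
  with L L^T = S (the law does not depend on the choice of L).\<close>
definition gaussian_vec :: "real^'l::finite \<Rightarrow> real^'l^'l \<Rightarrow> (real^'l) measure" where
  "gaussian_vec m S = distr (std_gauss :: (real^'l) measure) borel (\<lambda>z. m + (SOME L. L ** transpose L = S) *v z)"

text \<open>Canonical probability space of the noises: w = (w(t))_t iid N(mu,I),
  nu = (nu(t))_t iid N(0,Psi), the two sequences independent.\<close>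
definition noise_space ::
  "('n::finite, 'm::finite, 'l::finite, 'p::finite) slsys \<Rightarrow> ((nat \<Rightarrow> real^'l) \<times> (nat \<Rightarrow> real^'p)) measure" where
  "noise_space S =
     (PiM (UNIV::nat set) (\<lambda>_. gaussian_vec (sysMu S) (mat 1)))
     \<Otimes>\<^sub>M (PiM (UNIV::nat set) (\<lambda>_. gaussian_vec 0 (sysPsi S)))"

text \<open>State trajectory x|_{x0,u}(t) as a function of the noise sample.\<close>
primrec state_traj ::
  "('n::finite, 'm::finite, 'l::finite, 'p::finite) slsys \<Rightarrow> real^'n \<Rightarrow> (nat \<Rightarrow> real^'m)
     \<Rightarrow> (nat \<Rightarrow> real^'l) \<times> (nat \<Rightarrow> real^'p) \<Rightarrow> nat \<Rightarrow> real^'n" where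
  "state_traj S x0 u \<omega> 0 = x0"
| "state_traj S x0 u \<omega> (Suc t) =
     sysA S *v state_traj S x0 u \<omega> t + sysB S *v u t + sysG S *v (fst \<omega> t)"

text \<open>Output trajectory y|_{x0,u}(t) = C x(t) + nu(t).\<close>
definition out_traj ::
  "('n::finite, 'm::finite, 'l::finite, 'p::finite) slsys \<Rightarrow> real^'n \<Rightarrow> (nat \<Rightarrow> real^'m)
     \<Rightarrow> nat \<Rightarrow> (nat \<Rightarrow> real^'l) \<times> (nat \<Rightarrow> real^'p) \<Rightarrow> real^'p" where
  "out_traj S x0 u t \<omega> = sysC S *v state_traj S x0 u \<omega> t + snd \<omega> t"

text \<open>Law of the state x|_{x0,u}(t).\<close>
definition state_dist ::
  "('n::finite, 'm::finite, 'l::finite, 'p::finite) slsys \<Rightarrow> real^'n \<Rightarrow> (nat \<Rightarrow> real^'m)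
     \<Rightarrow> nat \<Rightarrow> (real^'n) measure" where
  "state_dist S x0 u t = distr (noise_space S) borel (\<lambda>\<omega>. state_traj S x0 u \<omega> t)"

text \<open>Support of a random vector with law D.\<close>
definition supp_dist :: "('a::metric_space) measure \<Rightarrow> 'a set" where
  "supp_dist D = {z. \<forall>\<rho>>0. measure D (ball z \<rho>) > 0}"

text \<open>Stochastic equivalence of processes: all finite-dimensional joint laws coincide.\<close>
definition stoch_equiv ::
  "'a measure \<Rightarrow> (nat \<Rightarrow> 'a \<Rightarrow> 'c::topological_space) \<Rightarrow> 'b measure \<Rightarrow> (nat \<Rightarrow> 'b \<Rightarrow> 'c) \<Rightarrow> bool" where
  "stoch_equiv M1 X1 M2 X2 \<longleftrightarrow>
     (\<forall>J. finite J \<longrightarrow>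
        distr M1 (PiM J (\<lambda>_. borel)) (\<lambda>\<omega>. \<lambda>t\<in>J. X1 t \<omega>) =
        distr M2 (PiM J (\<lambda>_. borel)) (\<lambda>\<omega>. \<lambda>t\<in>J. X2 t \<omega>))"

definition total_rel :: "('a \<times> 'b) set \<Rightarrow> bool" where
  "total_rel R \<longleftrightarrow> R `` UNIV = UNIV \<and> converse R `` UNIV = UNIV"

text \<open>Linear equivalence.\<close>
text \<open>Linear equivalence (G_2 = T G_1 forces l_1 = l_2, so both systems share the
  noise index type 'l).\<close>
definition lin_equiv ::
  "('n1::finite, 'm::finite, 'l::finite, 'p::finite) slsys \<Rightarrow>
   ('n2::finite, 'm, 'l, 'p) slsys \<Rightarrow> bool" where
  "lin_equiv S1 S2 \<longleftrightarrow> sysPsi S1 = sysPsi S2 \<and> CARD('n1) = CARD('n2) \<and>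
     (\<exists>(T::real^'n1^'n2) (Ti::real^'n2^'n1). T ** Ti = mat 1 \<and> Ti ** T = mat 1 \<and>
        sysA S2 = T ** sysA S1 ** Ti \<and> sysB S2 = T ** sysB S1 \<and>
        sysC S2 = sysC S1 ** Ti \<and> sysG S2 = T ** sysG S1 \<and>
        sysG S2 *v sysMu S2 = T *v (sysG S1 *v sysMu S1))"

text \<open>Equivalent stochastic external behaviour w.r.t. R.\<close>
definition ext_equiv_wrt ::
  "('n1::finite, 'm::finite, 'l1::finite, 'p::finite) slsys \<Rightarrow>
   ('n2::finite, 'm, 'l2::finite, 'p) slsys \<Rightarrow> ((real^'n1) \<times> (real^'n2)) set \<Rightarrow> bool" where
  "ext_equiv_wrt S1 S2 R \<longleftrightarrow>
     (\<forall>x1 x2 u. (x1, x2) \<in> R \<longrightarrow>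
        stoch_equiv (noise_space S1) (\<lambda>t. out_traj S1 x1 u t) (noise_space S2) (\<lambda>t. out_traj S2 x2 u t))"

definition ext_equiv ::
  "('n1::finite, 'm::finite, 'l1::finite, 'p::finite) slsys \<Rightarrow>
   ('n2::finite, 'm, 'l2::finite, 'p) slsys \<Rightarrow> bool" where
  "ext_equiv S1 S2 \<longleftrightarrow> (\<exists>R. subspace R \<and> total_rel R \<and> ext_equiv_wrt S1 S2 R)"

text \<open>Stochastic bisimulation relation.\<close>
definition stoch_bisim ::
  "('n1::finite, 'm::finite, 'l1::finite, 'p::finite) slsys \<Rightarrow>
   ('n2::finite, 'm, 'l2::finite, 'p) slsys \<Rightarrow> ((real^'n1) \<times> (real^'n2)) set \<Rightarrow> bool" where
  "stoch_bisim S1 S2 R \<longleftrightarrow> subspace R \<and>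
     (\<forall>x1 x2 u t. (x1, x2) \<in> R \<longrightarrow>
        (\<forall>X1 \<in> sets borel. X1 \<subseteq> converse R `` UNIV \<longrightarrow>
           measure (state_dist S1 x1 u t) X1 =
           measure (state_dist S2 x2 u t) (R `` (X1 \<inter> supp_dist (state_dist S1 x1 u t)))) \<and>
        (\<forall>X2 \<in> sets borel. X2 \<subseteq> R `` UNIV \<longrightarrow>
           measure (state_dist S2 x2 u t) X2 =
           measure (state_dist S1 x1 u t) (converse R `` (X2 \<inter> supp_dist (state_dist S2 x2 u t)))) \<and>
        stoch_equiv (noise_space S1) (\<lambda>t. out_traj S1 x1 u t) (noise_space S2) (\<lambda>t. out_traj S2 x2 u t))"

definition bis_equiv ::
  "('n1::finite, 'm::finite, 'l1::finite, 'p::finite) slsys \<Rightarrow>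
   ('n2::finite, 'm, 'l2::finite, 'p) slsys \<Rightarrow> bool" where
  "bis_equiv S1 S2 \<longleftrightarrow> (\<exists>R. total_rel R \<and> stoch_bisim S1 S2 R)"

end

theory Submission
  imports Defs
begin

text \<open>For (a), the bisimulation is the graph of the similarity \<open>T\<close>. From \<open>G\<^sub>2 = T G\<^sub>1\<close>
  and \<open>G\<^sub>2 \<mu>\<^sub>2 = T G\<^sub>1 \<mu>\<^sub>1\<close>, the difference \<open>c = \<mu>\<^sub>2 - \<mu>\<^sub>1\<close> lies in the kernel of \<open>G\<^sub>1\<close>.
  Translating the process noise by \<open>c\<close> carries the noise law of \<open>\<Sigma>\<^sub>1\<close> to that of \<open>\<Sigma>\<^sub>2\<close>,
  and pathwise it turns the trajectory of \<open>\<Sigma>\<^sub>2\<close> from \<open>T x\<close> into \<open>T\<close> times that of \<open>\<Sigma>\<^sub>1\<close>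
  from \<open>x\<close>, with identical outputs. So the state laws correspond under \<open>T\<close>, the output
  processes have the same laws, and the support clauses hold because a finite Borel measure
  on \<open>\<real>\<^sup>n\<close> gives full mass to its closed support. Part (b) is clause (iii) of the
  bisimulation. Neither part needs \<open>\<Psi>\<close> to be positive semidefinite.\<close>

abbreviation borel_paths :: "(nat \<Rightarrow> 'a::topological_space) measure" where
  "borel_paths \<equiv> PiM UNIV (\<lambda>_. borel)"

lemma borel_measurable_matrix_vector_mult [measurable]:
  "(\<lambda>x. (A::real^'n::finite^'m::finite) *v x) \<in> borel_measurable borel"
  by (intro borel_measurable_continuous_onI matrix_vector_mult_linear_continuous_on)

lemma measurable_vec_lambda_PiM:
  "(\<lambda>f. \<chi> i. f i) \<in> measurable (PiM (UNIV::'i::finite set) (\<lambda>_. borel)) (borel :: (real^'i) measure)"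
proof -
  have "(\<lambda>f. (\<chi> i. f i) \<bullet> b) \<in> borel_measurable (PiM (UNIV::'i set) (\<lambda>_. borel))"
    if "b \<in> Basis" for b :: "real^'i"
  proof -
    from that obtain j where "b = axis j 1" by (auto simp: Basis_vec_def)
    then have "(\<lambda>f. (\<chi> i. f i) \<bullet> b) = (\<lambda>f. f j)" by (simp add: inner_axis)
    then show ?thesis by simp
  qed
  then show ?thesis by (subst borel_measurable_euclidean_space) auto
qed

lemma distr_PiM_componentwise:
  assumes M: "\<And>i. i \<in> I \<Longrightarrow> prob_space (M i)"
  assumes f: "\<And>i. i \<in> I \<Longrightarrow> f i \<in> measurable (M i) (N i)"
  shows "distr (PiM I M) (PiM I N) (\<lambda>\<omega>. \<lambda>i\<in>I. f i (\<omega> i)) = PiM I (\<lambda>i. distr (M i) (N i) (f i))"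
    (is "distr ?K ?N ?t = ?I")
proof (rule measure_eqI_PiM_infinite[symmetric, where M=N])
  interpret prob_space ?I
    using f M by (intro prob_space_PiM prob_space.prob_space_distr) auto
  show "finite_measure ?I"
    by unfold_locales
  show "sets ?I = sets ?N" by (intro sets_PiM_cong) auto
  show "sets (distr ?K ?N ?t) = sets ?N" by simp
  fix A J assume J: "finite J" "J \<subseteq> I" and A: "\<And>i. i \<in> J \<Longrightarrow> A i \<in> sets (N i)"
  have "prod_emb I N J (Pi\<^sub>E J A) = prod_emb I (\<lambda>i. distr (M i) (N i) (f i)) J (Pi\<^sub>E J A)"
    by (simp add: prod_emb_def)
  then have "?I (prod_emb I N J (Pi\<^sub>E J A)) = (\<Prod>j\<in>J. distr (M j) (N j) (f j) (A j))"
    using f J A M by (simp add: emeasure_PiM_emb prob_space.prob_space_distr subsetD)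
  also have "\<dots> = (\<Prod>j\<in>J. M j (f j -` A j \<inter> space (M j)))"
    using J A f by (intro prod.cong refl emeasure_distr) auto
  also have "\<dots> = ?K (prod_emb I M J (\<Pi>\<^sub>E j\<in>J. f j -` A j \<inter> space (M j)))"
    using f J A by (intro emeasure_PiM_emb[symmetric] M) auto
  also have "prod_emb I M J (\<Pi>\<^sub>E j\<in>J. f j -` A j \<inter> space (M j)) =
      ?t -` prod_emb I N J (Pi\<^sub>E J A) \<inter> space ?K"
    using f J A by (auto simp: prod_emb_def space_PiM Pi_iff PiE_iff measurable_space subsetD)
       (meson measurable_space)
  also have "?K \<dots> = distr ?K ?N ?t (prod_emb I N J (Pi\<^sub>E J A))"
    using f J A by (intro emeasure_distr[symmetric] measurable_restrict sets_PiM_I)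
       (auto intro: measurable_compose[OF measurable_component_singleton])
  finally show "?I (prod_emb I N J (Pi\<^sub>E J A)) = distr ?K ?N ?t (prod_emb I N J (Pi\<^sub>E J A))" .
qed

lemma distr_pushforward:
  assumes "M' = distr M M' f" "f \<in> measurable M M'" "g \<in> measurable M' N"
    and "\<And>\<omega>. \<omega> \<in> space M \<Longrightarrow> g (f \<omega>) = h \<omega>"
  shows "distr M' N g = distr M N h"
proof -
  have "distr M' N g = distr M N (g \<circ> f)"
    using assms(1-3) by (metis distr_distr)
  also have "\<dots> = distr M N h"
    using assms(4) by (intro distr_cong) auto
  finally show ?thesis .
qed

lemma prob_space_std_gauss: "prob_space (std_gauss :: (real^'l::finite) measure)"
proof -
  have "sets (PiM (UNIV::'l set) (\<lambda>_. density lborel std_normal_density)) = sets (PiM UNIV (\<lambda>_. borel))"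
    by (intro sets_PiM_cong) auto
  then have "(\<lambda>f. \<chi> i. f i) \<in>
      measurable (PiM (UNIV::'l set) (\<lambda>_. density lborel std_normal_density)) (borel :: (real^'l) measure)"
    using measurable_vec_lambda_PiM measurable_cong_sets by blast
  then show ?thesis unfolding std_gauss_def
    by (intro prob_space.prob_space_distr prob_space_PiM prob_space_normal_density) auto
qed

lemma sets_std_gauss [simp, measurable_cong]: "sets (std_gauss :: (real^'l::finite) measure) = sets borel"
  by (simp add: std_gauss_def)

lemma sets_gaussian_vec [simp, measurable_cong]: "sets (gaussian_vec m S) = sets borel"
  by (simp add: gaussian_vec_def)

lemma prob_space_gaussian_vec: "prob_space (gaussian_vec m S)"
  unfolding gaussian_vec_def by (intro prob_space.prob_space_distr prob_space_std_gauss) simp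

lemma gaussian_vec_translate:
  "distr (gaussian_vec m S) borel (\<lambda>z. z + c) = gaussian_vec (m + c) S"
  unfolding gaussian_vec_def by (subst distr_distr) (auto simp: comp_def algebra_simps)

lemma sets_noise_space [measurable_cong]:
  "sets (noise_space S) = sets (borel_paths \<Otimes>\<^sub>M borel_paths)"
  unfolding noise_space_def by (intro sets_pair_measure_cong sets_PiM_cong) auto

lemma prob_space_noise_space: "prob_space (noise_space S)"
  unfolding noise_space_def by (intro prob_space_pair prob_space_PiM prob_space_gaussian_vec)

definition noise_shift ::
  "real^'l::finite \<Rightarrow> (nat \<Rightarrow> real^'l) \<times> 'b \<Rightarrow> (nat \<Rightarrow> real^'l) \<times> 'b" where
  "noise_shift c \<omega> = ((\<lambda>t\<in>UNIV. fst \<omega> t + c), snd \<omega>)"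

lemma measurable_noise_shift [measurable]:
  "noise_shift c \<in> measurable (noise_space S) (noise_space S')"
  unfolding noise_shift_def by measurable

lemma noise_space_translate:
  fixes S :: "('n::finite, 'm::finite, 'l::finite, 'p::finite) slsys"
    and S' :: "('n'::finite, 'm'::finite, 'l, 'p) slsys"
  assumes "sysPsi S' = sysPsi S"
  shows "noise_space S' = distr (noise_space S) (noise_space S') (noise_shift (sysMu S' - sysMu S))"
proof -
  let ?W = "\<lambda>\<mu>. PiM (UNIV::nat set) (\<lambda>_. gaussian_vec \<mu> (mat 1))"
  let ?V = "PiM (UNIV::nat set) (\<lambda>_. gaussian_vec 0 (sysPsi S))"
  let ?c = "sysMu S' - sysMu S"
  let ?shift = "\<lambda>w. \<lambda>t\<in>UNIV. w t + ?c"
  have "distr (?W (sysMu S)) (?W (sysMu S')) ?shift =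
      PiM UNIV (\<lambda>_. distr (gaussian_vec (sysMu S) (mat 1)) (gaussian_vec (sysMu S') (mat 1)) (\<lambda>z. z + ?c))"
    by (intro distr_PiM_componentwise prob_space_gaussian_vec) simp
  also have "\<dots> = ?W (sysMu S')"
    using gaussian_vec_translate[of "sysMu S" "mat 1" ?c] by (simp cong: distr_cong)
  finally have W: "distr (?W (sysMu S)) (?W (sysMu S')) ?shift = ?W (sysMu S')" .
  have "sigma_finite_measure (distr ?V ?V (\<lambda>v. v))"
    by (simp add: prob_space_imp_sigma_finite prob_space_PiM prob_space_gaussian_vec)
  then have "distr (?W (sysMu S) \<Otimes>\<^sub>M ?V) (?W (sysMu S') \<Otimes>\<^sub>M ?V) (\<lambda>(w, v). (?shift w, v)) =
      distr (?W (sysMu S)) (?W (sysMu S')) ?shift \<Otimes>\<^sub>M distr ?V ?V (\<lambda>v. v)"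
    using pair_measure_distr[of ?shift "?W (sysMu S)" "?W (sysMu S')" "\<lambda>v. v" ?V ?V] by simp
  also have "\<dots> = noise_space S'"
    unfolding W noise_space_def assms by simp
  finally show ?thesis
    unfolding noise_space_def noise_shift_def assms by (simp add: case_prod_beta')
qed

lemma measurable_state_traj [measurable]:
  "(\<lambda>\<omega>. state_traj S x u \<omega> t) \<in> borel_measurable (noise_space S)"
  by (induction t) simp_all

lemma measurable_out_traj [measurable]:
  "out_traj S x u t \<in> borel_measurable (noise_space S)"
  unfolding out_traj_def[abs_def] by measurable

lemma finite_measure_state_dist: "finite_measure (state_dist S x u t)"
proof -
  have "prob_space (state_dist S x u t)"
    unfolding state_dist_def by (intro prob_space.prob_space_distr prob_space_noise_space) simp
  then show ?thesis
    by (rule prob_space.axioms(1))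
qed

lemma sets_state_dist [simp]: "sets (state_dist S x u t) = sets borel"
  and space_state_dist [simp]: "space (state_dist S x u t) = UNIV"
  by (simp_all add: state_dist_def)

lemma compl_supp_dist_eq_Union_null_balls:
  fixes D :: "'a::metric_space measure"
  assumes "finite_measure D" "sets D = sets borel"
  shows "- supp_dist D = \<Union>{ball z \<rho> | z \<rho>. ball z \<rho> \<in> null_sets D}"
proof (intro equalityI subsetI)
  fix z assume "z \<in> - supp_dist D"
  then obtain \<rho> where "\<rho> > 0" "measure D (ball z \<rho>) \<le> 0"
    unfolding supp_dist_def by (auto simp: not_less)
  then have "ball z \<rho> \<in> null_sets D"
    using assms by (simp add: finite_measure.emeasure_eq_measure null_sets_def measure_le_0_iff)
  with \<open>\<rho> > 0\<close> show "z \<in> \<Union>{ball z \<rho> | z \<rho>. ball z \<rho> \<in> null_sets D}"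
    by (intro UnionI[of "ball z \<rho>"]) auto
next
  fix y assume "y \<in> \<Union>{ball z \<rho> | z \<rho>. ball z \<rho> \<in> null_sets D}"
  then obtain z \<rho> where y: "y \<in> ball z \<rho>" "ball z \<rho> \<in> null_sets D" by blast
  obtain r where r: "r > 0" "ball y r \<subseteq> ball z \<rho>"
    using open_ball y(1) by (rule openE)
  have "ball y r \<in> null_sets D"
    using y(2) r(2) assms(2) by (rule_tac null_sets_subset) auto
  then have "measure D (ball y r) = 0"
    by (simp add: measure_def null_setsD1)
  with r(1) show "y \<in> - supp_dist D"
    unfolding supp_dist_def by (auto intro!: exI[of _ r])
qed

lemma closed_supp_dist:
  fixes D :: "'a::metric_space measure"
  assumes "finite_measure D" "sets D = sets borel"
  shows "closed (supp_dist D)"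
  unfolding closed_def compl_supp_dist_eq_Union_null_balls[OF assms] by (intro open_Union) auto

lemma measure_Int_supp_dist:
  fixes D :: "'a::{metric_space, second_countable_topology} measure"
  assumes "finite_measure D" "sets D = sets borel" "X \<in> sets borel"
  shows "measure D (X \<inter> supp_dist D) = measure D X"
proof -
  let ?F = "{ball z \<rho> | z \<rho>. ball z \<rho> \<in> null_sets D}"
  obtain F' where F': "F' \<subseteq> ?F" "countable F'" "\<Union>F' = \<Union>?F"
    using Lindelof[of ?F] by force
  have "(\<Union>B\<in>F'. B) \<in> null_sets D"
    by (rule null_sets_UN'[OF F'(2)]) (use F'(1) in blast)
  then have "- supp_dist D \<in> null_sets D"
    unfolding compl_supp_dist_eq_Union_null_balls[OF assms(1,2)] F'(3)[symmetric] by simp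
  moreover have "X \<inter> supp_dist D = X - (- supp_dist D)" by auto
  ultimately show ?thesis
    using measure_Diff_null_set[of X D "- supp_dist D"] assms(2,3) by simp
qed

lemma subspace_graph:
  assumes "linear f"
  shows "subspace (range (\<lambda>x. (x, f x)))"
  unfolding subspace_def
proof (intro conjI ballI allI)
  show "0 \<in> range (\<lambda>x. (x, f x))"
    using assms by (intro image_eqI[of _ _ 0]) (simp_all add: linear_0 zero_prod_def)
next
  fix p q assume "p \<in> range (\<lambda>x. (x, f x))" "q \<in> range (\<lambda>x. (x, f x))"
  then show "p + q \<in> range (\<lambda>x. (x, f x))"
    by (auto simp flip: linear_add[OF assms])
next
  fix c :: real and p assume "p \<in> range (\<lambda>x. (x, f x))"
  then show "c *\<^sub>R p \<in> range (\<lambda>x. (x, f x))"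
    by (auto simp flip: linear_scale[OF assms])
qed

lemma total_rel_graph:
  assumes "surj f"
  shows "total_rel (range (\<lambda>x. (x, f x)))"
  unfolding total_rel_def
proof (intro conjI equalityI subsetI)
  fix y
  from assms obtain x where "y = f x" by (metis surjD)
  then show "y \<in> range (\<lambda>x. (x, f x)) `` UNIV" by blast
next
  fix x
  show "x \<in> (range (\<lambda>x. (x, f x)))\<inverse> `` UNIV" by blast
qed auto

lemma measure_distr_matrix_vector_mult:
  fixes T :: "real^'n::finite^'k::finite"
  assumes "sets D = sets borel" "B \<in> sets borel"
  shows "measure (distr D borel ((*v) T)) B = measure D ((*v) T -` B)"
proof -
  have "space D = UNIV"
    using assms(1) by (metis sets_eq_imp_space_eq space_borel)
  moreover have "(*v) T \<in> borel_measurable D"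
    unfolding measurable_cong_sets[OF assms(1) refl] by (rule borel_measurable_matrix_vector_mult)
  ultimately show ?thesis
    using assms(2) by (simp add: measure_distr)
qed

lemma measure_distr_vimage_inverse_Int_supp_dist:
  fixes T :: "real^'n::finite^'k::finite" and Ti :: "real^'k^'n"
  assumes "Ti ** T = mat 1" "finite_measure D" "sets D = sets borel" "X \<in> sets borel"
  shows "measure (distr D borel ((*v) T)) ((*v) Ti -` (X \<inter> supp_dist D)) = measure D X"
proof -
  have "X \<inter> supp_dist D \<in> sets borel"
    using assms closed_supp_dist[OF assms(2,3)] by (simp add: borel_closed sets.Int)
  then have "(*v) Ti -` (X \<inter> supp_dist D) \<in> sets borel"
    using measurable_sets[OF borel_measurable_matrix_vector_mult[of Ti]] by (simp del: vimage_Int)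
  moreover have "(*v) T -` (*v) Ti -` (X \<inter> supp_dist D) = X \<inter> supp_dist D"
    using assms(1) by (auto simp: matrix_vector_mul_assoc)
  ultimately have "measure (distr D borel ((*v) T)) ((*v) Ti -` (X \<inter> supp_dist D)) =
      measure D (X \<inter> supp_dist D)"
    using assms(3) by (simp add: measure_distr_matrix_vector_mult del: vimage_Int)
  also have "\<dots> = measure D X"
    using assms(2-4) by (rule measure_Int_supp_dist)
  finally show ?thesis .
qed

lemma measure_distr_eq_vimage_Int_supp_dist:
  fixes T :: "real^'n::finite^'k::finite"
  assumes "finite_measure D" "sets D = sets borel" "X \<in> sets borel"
  shows "measure (distr D borel ((*v) T)) X =
    measure D ((*v) T -` (X \<inter> supp_dist (distr D borel ((*v) T))))"
proof -
  let ?D' = "distr D borel ((*v) T)"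
  have "(*v) T \<in> borel_measurable D"
    unfolding measurable_cong_sets[OF assms(2) refl] by (rule borel_measurable_matrix_vector_mult)
  then have "finite_measure ?D'"
    by (rule finite_measure.finite_measure_distr[OF assms(1)])
  then have "X \<inter> supp_dist ?D' \<in> sets borel"
    using assms(3) closed_supp_dist[of ?D'] by (simp add: borel_closed sets.Int)
  then have "measure ?D' (X \<inter> supp_dist ?D') = measure D ((*v) T -` (X \<inter> supp_dist ?D'))"
    using assms(2) by (rule_tac measure_distr_matrix_vector_mult)
  moreover have "measure ?D' (X \<inter> supp_dist ?D') = measure ?D' X"
    using \<open>finite_measure ?D'\<close> assms(3) by (intro measure_Int_supp_dist) simp_all
  ultimately show ?thesis
    by simp
qed

lemma stoch_bisim_linear_graph:
  fixes S1 :: "('n1::finite, 'm::finite, 'l1::finite, 'p::finite) slsys"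
    and S2 :: "('n2::finite, 'm, 'l2::finite, 'p) slsys"
    and T :: "real^'n1^'n2" and Ti :: "real^'n2^'n1"
  assumes inverse: "Ti ** T = mat 1" "T ** Ti = mat 1"
    and state: "\<And>x u t. state_dist S2 (T *v x) u t = distr (state_dist S1 x u t) borel ((*v) T)"
    and outputs: "\<And>x u. stoch_equiv (noise_space S1) (\<lambda>t. out_traj S1 x u t)
                                   (noise_space S2) (\<lambda>t. out_traj S2 (T *v x) u t)"
  shows "stoch_bisim S1 S2 (range (\<lambda>x. (x, T *v x)))"
proof -
  let ?R = "range (\<lambda>x. (x, T *v x))"
  have image: "?R `` A = (*v) Ti -` A" for A
  proof (intro equalityI subsetI)
    fix y assume "y \<in> ?R `` A"
    then show "y \<in> (*v) Ti -` A"
      using inverse(1) by (auto simp: matrix_vector_mul_assoc)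
  next
    fix y assume "y \<in> (*v) Ti -` A"
    moreover have "(Ti *v y, y) \<in> ?R"
      using inverse(2) by (metis rangeI matrix_vector_mul_assoc matrix_vector_mul_lid)
    ultimately show "y \<in> ?R `` A"
      by auto
  qed
  have preimage: "converse ?R `` B = (*v) T -` B" for B
    by auto
  have "subspace ?R"
    by (intro subspace_graph matrix_vector_mul_linear)
  then show ?thesis
    unfolding stoch_bisim_def image preimage
  proof (intro conjI allI impI ballI)
    fix x1 x2 u t assume "(x1, x2) \<in> ?R"
    then have x2: "x2 = T *v x1" by auto
    show "measure (state_dist S1 x1 u t) X1 =
        measure (state_dist S2 x2 u t) ((*v) Ti -` (X1 \<inter> supp_dist (state_dist S1 x1 u t)))"
      if "X1 \<in> sets borel" for X1
      unfolding x2 state using inverse(1) finite_measure_state_dist sets_state_dist that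
      by (rule measure_distr_vimage_inverse_Int_supp_dist[symmetric])
    show "measure (state_dist S2 x2 u t) X2 =
        measure (state_dist S1 x1 u t) ((*v) T -` (X2 \<inter> supp_dist (state_dist S2 x2 u t)))"
      if "X2 \<in> sets borel" for X2
      unfolding x2 state using finite_measure_state_dist sets_state_dist that
      by (rule measure_distr_eq_vimage_Int_supp_dist)
  next
    fix x1 x2 u assume "(x1, x2) \<in> ?R"
    then show "stoch_equiv (noise_space S1) (\<lambda>t. out_traj S1 x1 u t)
                           (noise_space S2) (\<lambda>t. out_traj S2 x2 u t)"
      using outputs by auto
  qed
qed

lemma state_traj_similarity:
  fixes S1 :: "('n1::finite, 'm::finite, 'l::finite, 'p::finite) slsys"
    and S2 :: "('n2::finite, 'm, 'l, 'p) slsys"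
    and T :: "real^'n1^'n2" and Ti :: "real^'n2^'n1"
  assumes "Ti ** T = mat 1" "sysA S2 = T ** sysA S1 ** Ti" "sysB S2 = T ** sysB S1"
    and "sysG S2 = T ** sysG S1" "sysG S1 *v c = 0"
  shows "state_traj S2 (T *v x) u (noise_shift c \<omega>) t = T *v state_traj S1 x u \<omega> t"
proof (induction t)
  case (Suc t)
  have "sysA S2 *v (T *v y) = T *v (sysA S1 *v y)" for y
    using assms(1,2) by (simp add: matrix_vector_mul_assoc matrix_mul_assoc[symmetric])
  moreover have "sysG S2 *v (w + c) = T *v (sysG S1 *v w)" for w
    using assms(4,5) by (simp add: matrix_vector_mul_assoc[symmetric] matrix_vector_right_distrib)
  ultimately show ?case
    using Suc assms(3)
    by (simp add: noise_shift_def matrix_vector_mul_assoc[symmetric] matrix_vector_right_distrib)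
qed simp

lemma out_traj_similarity:
  fixes S1 :: "('n1::finite, 'm::finite, 'l::finite, 'p::finite) slsys"
    and S2 :: "('n2::finite, 'm, 'l, 'p) slsys"
    and T :: "real^'n1^'n2" and Ti :: "real^'n2^'n1"
  assumes "Ti ** T = mat 1" "sysA S2 = T ** sysA S1 ** Ti" "sysB S2 = T ** sysB S1"
    and "sysC S2 = sysC S1 ** Ti" "sysG S2 = T ** sysG S1" "sysG S1 *v c = 0"
  shows "out_traj S2 (T *v x) u t (noise_shift c \<omega>) = out_traj S1 x u t \<omega>"
  using assms state_traj_similarity[of Ti T S2 S1 c x u \<omega> t]
  by (simp add: out_traj_def noise_shift_def matrix_vector_mul_assoc matrix_mul_assoc[symmetric])

lemma bis_equiv_if_lin_equiv:
  fixes S1 :: "('n1::finite, 'm::finite, 'l::finite, 'p::finite) slsys"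
    and S2 :: "('n2::finite, 'm, 'l, 'p) slsys"
  assumes "lin_equiv S1 S2"
  shows "bis_equiv S1 S2"
proof -
  obtain T :: "real^'n1^'n2" and Ti :: "real^'n2^'n1" where
    inverse: "T ** Ti = mat 1" "Ti ** T = mat 1" and
    A: "sysA S2 = T ** sysA S1 ** Ti" and B: "sysB S2 = T ** sysB S1" and
    C: "sysC S2 = sysC S1 ** Ti" and G: "sysG S2 = T ** sysG S1" and
    mean: "sysG S2 *v sysMu S2 = T *v (sysG S1 *v sysMu S1)" and Psi: "sysPsi S1 = sysPsi S2"
    using assms unfolding lin_equiv_def by blast
  define c where "c = sysMu S2 - sysMu S1"
  have "sysG S1 *v sysMu S2 = sysG S1 *v sysMu S1"
    using arg_cong[OF mean, of "(*v) Ti"] inverse(2) G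
    by (simp add: matrix_vector_mul_assoc matrix_mul_assoc)
  then have Gc: "sysG S1 *v c = 0"
    by (simp add: c_def matrix_vector_mult_diff_distrib)
  have noise: "noise_space S2 = distr (noise_space S1) (noise_space S2) (noise_shift c)"
    unfolding c_def using Psi by (intro noise_space_translate) simp
  have state: "state_dist S2 (T *v x) u t = distr (state_dist S1 x u t) borel ((*v) T)" for x u t
  proof -
    have "state_dist S2 (T *v x) u t =
        distr (noise_space S1) borel (\<lambda>\<omega>. T *v state_traj S1 x u \<omega> t)"
      unfolding state_dist_def using inverse A B G Gc
      by (intro distr_pushforward[OF noise]) (simp_all add: state_traj_similarity)
    also have "\<dots> = distr (state_dist S1 x u t) borel ((*v) T)"
      unfolding state_dist_def by (subst distr_distr) (simp_all add: comp_def)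
    finally show ?thesis .
  qed
  have outputs: "stoch_equiv (noise_space S1) (\<lambda>t. out_traj S1 x u t)
                             (noise_space S2) (\<lambda>t. out_traj S2 (T *v x) u t)" for x u
    unfolding stoch_equiv_def using inverse A B C G Gc
    by (auto intro!: distr_pushforward[OF noise, symmetric] simp: out_traj_similarity)
  have "surj ((*v) T)"
    by (metis surjI matrix_vector_mul_assoc inverse(1) matrix_vector_mul_lid)
  then show ?thesis
    unfolding bis_equiv_def
    using total_rel_graph stoch_bisim_linear_graph[OF inverse(2,1) state outputs] by blast
qed

lemma ext_equiv_if_bis_equiv: "bis_equiv S1 S2 \<Longrightarrow> ext_equiv S1 S2"
  unfolding bis_equiv_def ext_equiv_def ext_equiv_wrt_def stoch_bisim_def by blast

theorem proposition1:
  fixes S1 :: "('n1::finite, 'm::finite, 'l::finite, 'p::finite) slsys"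
    and S2 :: "('n2::finite, 'm, 'l, 'p) slsys"
    and S3 :: "('n3::finite, 'm2::finite, 'l3::finite, 'p2::finite) slsys"
    and S4 :: "('n4::finite, 'm2, 'l4::finite, 'p2) slsys"
  assumes "valid_sys S1" and "valid_sys S2" and "valid_sys S3" and "valid_sys S4"
  shows "(lin_equiv S1 S2 \<longrightarrow> bis_equiv S1 S2) \<and> (bis_equiv S3 S4 \<longrightarrow> ext_equiv S3 S4)"
  using bis_equiv_if_lin_equiv ext_equiv_if_bis_equiv by blast

end
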